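(* Let $r$ be a positive integer and $N(u)=(u-1)^r$, and write $\zeta_{\mathbb{G}_{\rm m}^{\otimes r}}=\zeta_N$. Then $\dfrac{\zeta_{\mathbb{G}_{\rm m}^{\otimes r}}(s)}{\zeta_{\mathbb{G}_{\rm m}^{\otimes r}}(r-s)^{(-1)^r}}=S_{-r}(s-r)^{-1}.$
   Context: For $N:(1,\infty)\to\mathbb{C}$, $Z_N(w;s)=\frac{1}{\Gamma(w)}\int_1^\infty N(u)u^{-s-1}(\log u)^{w-1}du$, defined where convergent and extended to all $w$ by analytic continuation in $w$; $\zeta_N(s)=\exp\left(\left.\frac{\partial}{\partial w}Z_N(w;s)\right|_{w=0}\right)$ (a rational function of $s$ here, extended accordingly). For the negative integer $-r$, $\zeta_{-r}(w;x)=\sum_{n=0}^{r}(-1)^n\binom{r}{n}(n+x)^{-w}$ (principal branch), $\Gamma_{-r}(x)=\exp\left(\left.\frac{\partial}{\partial w}\zeta_{-r}(w;x)\right|_{w=0}\right)$, and $S_{-r}(x)=\Gamma_{-r}(x)^{-1}\Gamma_{-r}(-r-x)^{(-1)^{r}}$. *)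

theory Defs
  imports "HOL-Analysis.Analysis" "HOL-Computational_Algebra.Polynomial"
begin

text \<open>Only the values of \<open>N\<close> on \<open>{1<..}\<close> matter below. Convergence is
  absolute (Lebesgue) convergence.\<close>

definition Z_integrand :: "(real \<Rightarrow> complex) \<Rightarrow> complex \<Rightarrow> complex \<Rightarrow> real \<Rightarrow> complex" where
  "Z_integrand N s w u = N u * of_real u powr (- s - 1) * of_real (ln u) powr (w - 1)"

definition Z_conv_domain :: "(real \<Rightarrow> complex) \<Rightarrow> complex \<Rightarrow> complex set" where
  "Z_conv_domain N s = {w. Z_integrand N s w absolutely_integrable_on {1<..}}"

text \<open>\<open>rGamma\<close> is the entire function \<open>1/Gamma\<close>, so nonpositive integers \<open>w\<close> in the domain of
  convergence need no special treatment.\<close>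

definition Z_integral :: "(real \<Rightarrow> complex) \<Rightarrow> complex \<Rightarrow> complex \<Rightarrow> complex" where
  "Z_integral N s w = rGamma w * integral {1<..} (Z_integrand N s w)"

text \<open>\<open>Z\<close> is the analytic continuation of \<open>w \<mapsto> Z_N(w;s)\<close> to the whole plane; the condition on
  the interior makes it unique.\<close>

definition Z_continuation ::
    "(real \<Rightarrow> complex) \<Rightarrow> complex \<Rightarrow> (complex \<Rightarrow> complex) \<Rightarrow> bool" where
  "Z_continuation N s Z \<longleftrightarrow>
     interior (Z_conv_domain N s) \<noteq> {} \<and>
     Z holomorphic_on UNIV \<and>
     (\<forall>w \<in> Z_conv_domain N s. Z w = Z_integral N s w)"

text \<open>The rational function of \<open>s\<close> that equals \<open>exp (\<partial>/\<partial>w Z_N(w;s) at w = 0)\<close> on some right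
  half-plane. It is written in lowest terms, so it is determined at every point; its value at a
  pole is the conventional \<open>0\<close>.\<close>

definition abs_zeta :: "(real \<Rightarrow> complex) \<Rightarrow> complex \<Rightarrow> complex" where
  "abs_zeta N = (THE R. \<exists>p q :: complex poly.
      q \<noteq> 0 \<and> coprime p q \<and> R = (\<lambda>s. poly p s / poly q s) \<and>
      (\<exists>\<sigma>::real. \<forall>s. Re s > \<sigma> \<longrightarrow>
         (\<exists>Z. Z_continuation N s Z \<and> R s = exp (deriv Z 0))))"

definition zeta_Gm_tensor :: "nat \<Rightarrow> complex \<Rightarrow> complex" where
  "zeta_Gm_tensor r = abs_zeta (\<lambda>u. of_real ((u - 1) ^ r))"

text \<open>In the following three definitions the argument \<open>r\<close> stands for the order \<open>-r\<close>. They are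
  meaningful when no \<open>of_nat n + x\<close> with \<open>n \<le> r\<close> vanishes; note that \<open>0 powr _ = 0\<close>.\<close>

definition zeta_neg :: "nat \<Rightarrow> complex \<Rightarrow> complex \<Rightarrow> complex" where
  "zeta_neg r w x = (\<Sum>n=0..r. (-1) ^ n * of_nat (r choose n) * (of_nat n + x) powr (- w))"

definition Gamma_neg :: "nat \<Rightarrow> complex \<Rightarrow> complex" where
  "Gamma_neg r x = exp (deriv (\<lambda>w. zeta_neg r w x) 0)"

definition S_neg :: "nat \<Rightarrow> complex \<Rightarrow> complex" where
  "S_neg r x = inverse (Gamma_neg r x) * Gamma_neg r (- of_nat r - x) powi ((-1) ^ r)"

end

theory Submission
  imports Defs "HOL-Complex_Analysis.Conformal_Mappings" "HOL-Real_Asymp.Real_Asymp"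
    "HOL-Computational_Algebra.Field_as_Ring" "HOL-Computational_Algebra.Polynomial_Factorial"
begin

text \<open>Substituting \<open>u = e\<^sup>t\<close> and expanding \<open>(e\<^sup>t - 1)\<^sup>r\<close> gives
  \<open>Z_N(w;s) = \<Sum>\<^sub>k (-1)\<^bsup>r-k\<^esup> (r choose k) (s - k)\<^bsup>-w\<^esup>\<close> for \<open>Re w > 0\<close> and \<open>Re s > r\<close>. Since
  \<open>(e\<^sup>t - 1)\<^sup>r\<close> vanishes to order \<open>r\<close> at \<open>0\<close>, the integral converges exactly for \<open>Re w > -r\<close>;
  integration by parts lowers \<open>Re w\<close> and carries the formula to that whole half-plane. The
  right-hand side is entire in \<open>w\<close> and equals \<open>\<zeta>\<^sub>-\<^sub>r(w; s - r)\<close> after \<open>k \<mapsto> r - k\<close>. Hence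
  \<open>\<zeta>\<^sub>N(s) = \<Gamma>\<^sub>-\<^sub>r(s - r)\<close>, first for \<open>Re s > r\<close>; both sides are the rational function
  \<open>\<Prod>\<^sub>k (s - k)\<close> to the power \<open>(-1)\<^bsup>r-k+1\<^esup> (r choose k)\<close>, so this holds off \<open>{0..r}\<close>. The
  functional equation is then the definition of \<open>S\<^sub>-\<^sub>r\<close>.\<close>

subsection \<open>The Gamma integral with a complex exponential\<close>

lemma Gamma_kernel_lebesgue:
  assumes "Re w > 0"
  shows "integrable (lebesgue_on {0<..}) (\<lambda>t. of_real t powr (w - 1) / of_real (exp t) :: complex)"
    and "integral\<^sup>L (lebesgue_on {0<..}) (\<lambda>t. of_real t powr (w - 1) / of_real (exp t)) = Gamma w"
proof -
  show *: "integrable (lebesgue_on {0<..}) (\<lambda>t. of_real t powr (w - 1) / of_real (exp t) :: complex)"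
    using absolutely_integrable_Gamma_integral'[OF assms]
    by (rule absolutely_integrable_imp_integrable) simp
  show "integral\<^sup>L (lebesgue_on {0<..}) (\<lambda>t. of_real t powr (w - 1) / of_real (exp t)) = Gamma w"
    using lebesgue_integral_eq_integral[OF *] Gamma_integral_complex'[OF assms]
    by (simp add: integral_unique)
qed

lemma Gamma_kernel_lebesgue_real:
  fixes x :: real
  assumes "x > 0"
  shows "integral\<^sup>L (lebesgue_on {0<..}) (\<lambda>t. t powr (x - 1) / exp t) = Gamma x"
proof -
  have "integral\<^sup>L (lebesgue_on {0<..}) (\<lambda>t. complex_of_real (t powr (x - 1) / exp t)) =
        integral\<^sup>L (lebesgue_on {0<..}) (\<lambda>t. of_real t powr (of_real x - 1) / of_real (exp t))"
  proof (rule Bochner_Integration.integral_cong[OF refl])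
    fix t :: real assume "t \<in> space (lebesgue_on {0<..})"
    then have "complex_of_real (t powr (x - 1)) = of_real t powr (of_real (x - 1))"
      by (intro powr_of_real[symmetric]) simp
    then show "complex_of_real (t powr (x - 1) / exp t) = of_real t powr (of_real x - 1) / of_real (exp t)"
      by simp
  qed
  also have "\<dots> = of_real (Gamma x)"
    using assms by (subst Gamma_kernel_lebesgue(2)) (simp_all add: Gamma_complex_of_real)
  finally show ?thesis
    by (simp only: integral_complex_of_real of_real_eq_iff)
qed

text \<open>Positivity of \<open>Re w\<close> keeps both arguments off the poles, so the pochhammer
  identity for \<open>rGamma\<close> can be inverted.\<close>

lemma Gamma_add_of_nat:
  fixes w :: complex
  assumes "Re w > 0"
  shows "Gamma (w + of_nat n) = pochhammer w n * Gamma w"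
proof -
  have "w \<notin> \<int>\<^sub>\<le>\<^sub>0" "w + of_nat n \<notin> \<int>\<^sub>\<le>\<^sub>0"
    using assms by (auto elim!: nonpos_Ints_cases' simp: complex_eq_iff)
  then have "Gamma w \<noteq> 0" "Gamma (w + of_nat n) \<noteq> 0"
    by (auto simp: Gamma_eq_zero_iff)
  then show ?thesis
    using pochhammer_rGamma[of w n] by (simp add: rGamma_inverse_Gamma field_simps)
qed

text \<open>Expand \<open>e\<^bsup>-at\<^esup> = e\<^bsup>-t\<^esup> e\<^bsup>(1-a)t\<^esup>\<close> in powers of \<open>(1 - a) t\<close> and integrate termwise: the result is the
  binomial series of \<open>a\<^bsup>-w\<^esup>\<close>.\<close>

lemma gamma_exp_near_1:
  assumes w: "Re w > 0" and a: "norm (1 - a) < 1"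
  shows "integrable (lebesgue_on {0<..}) (\<lambda>t. of_real t powr (w - 1) * exp (- (a * of_real t)))" (is "integrable ?M ?h")
    and "integral\<^sup>L (lebesgue_on {0<..}) (\<lambda>t. of_real t powr (w - 1) * exp (- (a * of_real t))) = Gamma w * a powr (- w)"
proof -
  define f :: "nat \<Rightarrow> real \<Rightarrow> complex" where
    "f = (\<lambda>n t. (1 - a) ^ n / fact n * (of_real t powr (w + of_nat n - 1) / of_real (exp t)))"
  define c where "c = (\<lambda>n. ((- w) gchoose n) * (a - 1) ^ n)"
  have wn: "Re (w + of_nat n) > 0" for n using w by simp
  have int: "integrable ?M (f n)" for n
    unfolding f_def using Gamma_kernel_lebesgue(1)[OF wn] by (rule integrable_mult_right)
  have val: "integral\<^sup>L ?M (f n) = Gamma w * c n" for n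
  proof -
    have "(1 - a) ^ n = (-1) ^ n * (a - 1) ^ n"
      by (simp flip: power_mult_distrib)
    moreover have "integral\<^sup>L ?M (f n) = (1 - a) ^ n / fact n * Gamma (w + of_nat n)"
      unfolding f_def by (subst Bochner_Integration.integral_mult_right_zero) (simp only: Gamma_kernel_lebesgue(2)[OF wn])
    ultimately show ?thesis
      by (simp add: Gamma_add_of_nat[OF w] c_def gbinomial_pochhammer)
  qed
  have nf: "norm (f n t) = norm (1 - a) ^ n / fact n * (t powr (Re w + real n - 1) / exp t)" if "t > 0" for n t
    using that by (simp add: f_def norm_mult norm_divide norm_power norm_powr_real_powr)
  \<comment> \<open>The integrals of the norms are again terms of a binomial series, with exponent
    \<open>- Re w\<close> at the point \<open>- norm (1 - a)\<close>; it converges since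
    \<open>norm (1 - a) < 1\<close>. This justifies termwise integration.\<close>
  have normval: "(\<integral>t. norm (f n t) \<partial>?M) = Gamma (Re w) * (((- Re w) gchoose n) * (- norm (1 - a)) ^ n)" for n
  proof -
    have "(\<integral>t. norm (f n t) \<partial>?M) = (\<integral>t. norm (1 - a) ^ n / fact n * (t powr (Re w + real n - 1) / exp t) \<partial>?M)"
      by (rule Bochner_Integration.integral_cong) (auto simp: nf)
    also have "\<dots> = norm (1 - a) ^ n / fact n * Gamma (Re w + real n)"
      by (subst Bochner_Integration.integral_mult_right_zero) (use w in \<open>simp add: Gamma_kernel_lebesgue_real\<close>)
    also have "Gamma (Re w + real n) = pochhammer (Re w) n * Gamma (Re w)"
    proof -
      have "complex_of_real (Gamma (Re w + real n)) = of_real (pochhammer (Re w) n * Gamma (Re w))"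
        using Gamma_add_of_nat[of "of_real (Re w)" n] w
        by (simp flip: Gamma_complex_of_real add: pochhammer_of_real)
      then show ?thesis by (simp only: of_real_eq_iff)
    qed
    finally show ?thesis
      by (simp add: gbinomial_pochhammer power_minus[of "norm _"])
  qed
  have sm: "summable (\<lambda>n. \<integral>t. norm (f n t) \<partial>?M)"
    unfolding normval using gen_binomial_real[of "- norm (1 - a)" "- Re w"] a
    by (intro summable_mult) (auto simp: sums_iff)
  have hs: "(\<lambda>n. f n t) sums ?h t" if "t > 0" for t
  proof -
    have "(\<lambda>n. of_real t powr (w - 1) / of_real (exp t) * (((1 - a) * of_real t) ^ n /\<^sub>R fact n)) sums
       (of_real t powr (w - 1) / of_real (exp t) * exp ((1 - a) * of_real t))"
      by (intro sums_mult exp_converges)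
    also have "(\<lambda>n. of_real t powr (w - 1) / of_real (exp t) * (((1 - a) * of_real t) ^ n /\<^sub>R fact n)) = (\<lambda>n. f n t)"
    proof
      fix n
      have "complex_of_real t powr (w + of_nat n - 1) = of_real t powr (w - 1) * of_real t powr of_nat n"
        by (simp flip: powr_add add: algebra_simps)
      also have "complex_of_real t powr of_nat n = of_real t ^ n" using that by (simp add: powr_nat)
      finally show "of_real t powr (w - 1) / of_real (exp t) * (((1 - a) * of_real t) ^ n /\<^sub>R fact n) = f n t"
        by (simp add: f_def power_mult_distrib scaleR_conv_of_real divide_inverse mult_ac)
    qed
    also have "(of_real t powr (w - 1) / of_real (exp t) * exp ((1 - a) * of_real t)) = ?h t"
    proof -
      have "exp ((1 - a) * of_real t) = of_real (exp t) * exp (- (a * of_real t))"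
        by (simp only: exp_of_real[symmetric] exp_add[symmetric]) (simp add: algebra_simps)
      then show ?thesis by simp
    qed
    finally show ?thesis .
  qed
  have as: "AE t in ?M. summable (\<lambda>n. norm (f n t))"
  proof (rule AE_I2)
    fix t assume "t \<in> space ?M"
    then have t: "t > 0" by simp
    have "norm (f n t) = t powr (Re w - 1) / exp t * ((norm (1 - a) * t) ^ n /\<^sub>R fact n)" for n
    proof -
      have "t powr (Re w + n - 1) = t powr (Re w - 1) * t powr n"
        by (simp flip: powr_add add: algebra_simps)
      then show ?thesis
        using t by (simp add: f_def norm_mult norm_divide norm_power norm_powr_real_powr powr_realpow
          power_mult_distrib field_simps)
    qed
    then show "summable (\<lambda>n. norm (f n t))"
      using exp_converges[of "norm (1 - a) * t"] by (auto intro!: summable_mult simp: sums_iff)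
  qed
  note S = int as sm
  have eq: "(\<Sum>n. f n t) = ?h t" if "t \<in> space ?M" for t
    using hs[of t] that by (simp add: sums_iff)
  show "integrable ?M ?h"
    using integrable_suminf[OF S] by (subst Bochner_Integration.integrable_cong[OF refl eq[symmetric]])
  have "(\<lambda>n. integral\<^sup>L ?M (f n)) sums (\<integral>t. (\<Sum>n. f n t) \<partial>?M)"
    by (rule sums_integral[OF S])
  also have "(\<integral>t. (\<Sum>n. f n t) \<partial>?M) = integral\<^sup>L ?M ?h"
    by (rule Bochner_Integration.integral_cong[OF refl eq])
  finally have "(\<lambda>n. Gamma w * c n) sums integral\<^sup>L ?M ?h" by (simp only: val)
  moreover have "(\<lambda>n. Gamma w * c n) sums (Gamma w * a powr (- w))"
    using gen_binomial_complex[of "a - 1" "- w"] a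
    by (intro sums_mult) (simp add: c_def norm_minus_commute)
  ultimately show "integral\<^sup>L ?M ?h = Gamma w * a powr (- w)"
    by (rule sums_unique2)
qed

lemma gamma_exp_integral:
  assumes w: "Re w > 0" and a: "Re a > 0"
  shows "(\<lambda>t. of_real t powr (w - 1) * exp (- (a * of_real t))) absolutely_integrable_on {0<..}"
    and "integral {0<..} (\<lambda>t. of_real t powr (w - 1) * exp (- (a * of_real t))) = Gamma w * a powr (- w)"
proof -
  \<comment> \<open>\<open>b\<close> is large enough that the disc of radius \<open>b\<close> about \<open>b\<close> contains \<open>a\<close>; rescale \<open>t\<close> by \<open>b\<close>.\<close>
  define b where "b = (norm a)\<^sup>2 / Re a"
  have na: "norm a > 0" using a by auto
  have b: "b > 0" using a na by (simp add: b_def)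
  define a' where "a' = a / of_real b"
  have aa: "a = of_real b * a'" using b by (simp add: a'_def)
  \<comment> \<open>The choice of \<open>b\<close> gives \<open>b * Re a = (norm a)^2\<close>, so
    the squared distance from \<open>b\<close> to \<open>a\<close> is
    \<open>b^2 - (norm a)^2\<close>.\<close>
  have n1: "norm (1 - a') < 1"
  proof -
    have "b * Re a = (norm a)\<^sup>2" using a by (simp add: b_def)
    moreover have "norm (of_real b - a) ^ 2 = b\<^sup>2 - 2 * b * Re a + (norm a)\<^sup>2"
      unfolding cmod_power2 by (simp add: power2_eq_square algebra_simps)
    ultimately have "norm (of_real b - a) ^ 2 < b ^ 2" using zero_less_power[OF na, of 2] by linarith
    then have "norm (of_real b - a) < b" using b by (simp add: power2_less_imp_less)
    moreover have "1 - a' = (of_real b - a) / of_real b" using b by (simp add: a'_def field_simps)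
    ultimately show ?thesis using b by (simp add: norm_divide)
  qed
  let ?h = "\<lambda>a t. of_real t powr (w - 1) * exp (- (a * complex_of_real t))"
  note G = gamma_exp_near_1[OF w n1]
  have abs1: "?h a' absolutely_integrable_on {0<..}"
    using G(1) by (simp add: set_integrable_def integrable_restrict_space)
  have int1: "integral {0<..} (?h a') = Gamma w * a' powr (- w)"
    using G lebesgue_integral_eq_integral[OF G(1)] by simp
  have img: "(\<lambda>t. b * t) ` {0<..} = {0<..}"
  proof -
    have "t \<in> (\<lambda>t. b * t) ` {0<..}" if "t > 0" for t
      using that b by (intro image_eqI[of _ _ "t / b"]) auto
    then show ?thesis using b by auto
  qed
  have "?h a' absolutely_integrable_on (\<lambda>t. b * t) ` {0<..} \<and> integral ((\<lambda>t. b * t) ` {0<..}) (?h a') = Gamma w * a' powr (- w)"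
    using abs1 int1 by (simp only: img)
  then have cv: "(\<lambda>t. \<bar>b\<bar> *\<^sub>R ?h a' (b * t)) absolutely_integrable_on {0<..}" "integral {0<..} (\<lambda>t. \<bar>b\<bar> *\<^sub>R ?h a' (b * t)) = Gamma w * a' powr (- w)"
    by (subst (asm) has_absolute_integral_change_of_variables_real
          [where h = "\<lambda>_. b" and g = "\<lambda>t. b * t", symmetric];
        use b in \<open>force intro!: derivative_eq_intros simp: inj_on_def\<close>)+
  have pt: "\<bar>b\<bar> *\<^sub>R ?h a' (b * t) = of_real b powr w * ?h a t" if "t \<in> {0<..}" for t
  proof -
    have "complex_of_real (b * t) powr (w - 1) = of_real b powr (w - 1) * of_real t powr (w - 1)"
      using b that by (simp add: powr_times_real)
    moreover have "of_real b * complex_of_real b powr (w - 1) = of_real b powr w"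
      using b by (simp add: powr_diff)
    ultimately show ?thesis using b by (simp add: scaleR_conv_of_real aa mult_ac)
  qed
  have *: "(\<lambda>t. of_real b powr w * ?h a t) absolutely_integrable_on {0<..}"
    using cv(1) by (rule set_integrable_cong[THEN iffD1, OF refl refl pt, rotated])
  have **: "integral {0<..} (\<lambda>t. of_real b powr w * ?h a t) = Gamma w * a' powr (- w)"
    by (rule trans[OF Henstock_Kurzweil_Integration.integral_cong[OF pt, symmetric] cv(2)])
  have nz: "complex_of_real b powr w \<noteq> 0" using b by simp
  show "?h a absolutely_integrable_on {0<..}"
    using * nz by (simp add: set_integrable_mult_right_iff)
  have "of_real b powr w * integral {0<..} (?h a) = Gamma w * a' powr (- w)"
    using ** by simp
  \<comment> \<open>A positive real factor does not change the argument, so \<open>powr\<close>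
    splits without a branch correction.\<close>
  moreover have "a' powr (- w) = of_real b powr w * a powr (- w)"
  proof -
    have "a powr (- w) = of_real b powr (- w) * a' powr (- w)"
      unfolding aa using b by (intro powr_times_real_left) auto
    then show ?thesis using nz by (simp add: powr_minus field_simps)
  qed
  ultimately have "of_real b powr w * integral {0<..} (?h a) = of_real b powr w * (Gamma w * a powr (- w))" by simp
  then show "integral {0<..} (?h a) = Gamma w * a powr (- w)"
    using nz by (metis mult_cancel_left)
qed

text \<open>The fundamental theorem of calculus on the half-line; it serves integration by parts
  with vanishing boundary terms.\<close>

lemma integral_derivative_zero_limits:
  fixes F f :: "real \<Rightarrow> complex"
  assumes F: "\<And>t. t > 0 \<Longrightarrow> (F has_vector_derivative f t) (at t)"
    and f: "continuous_on {0<..} f" "f absolutely_integrable_on {0<..}"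
    and F0: "(F \<longlongrightarrow> 0) (at_right 0)" and Finf: "(F \<longlongrightarrow> 0) at_top"
  shows "integral {0<..} f = 0"
proof -
  have ei: "einterval 0 \<infinity> = {0<..}" by (auto simp: einterval_def)
  \<comment> \<open>The fundamental theorem is applied over \<open>lborel\<close>, so integrability
    must descend from the completed measure; continuity of \<open>f\<close> supplies Borel
    measurability.\<close>
  have "set_integrable lborel {0<..} f"
  proof -
    have "(\<lambda>x. indicat_real {0<..} x *\<^sub>R f x) \<in> borel_measurable borel"
      by (rule borel_measurable_continuous_on_indicator) (use f in auto)
    then show ?thesis
      using f(2) unfolding set_integrable_def by (subst (asm) integrable_completion) auto
  qed
  then have si: "set_integrable lborel (einterval 0 \<infinity>) f" by (simp add: ei)
  have "(LBINT x=0..\<infinity>. f x) = 0 - 0"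
  proof (rule interval_integral_FTC_integrable[where F = F])
    show "isCont f x" if "0 < ereal x" "ereal x < \<infinity>" for x
      using that f(1) by (simp add: continuous_on_eq_continuous_at)
  qed (use F si in \<open>auto simp: zero_ereal_def ereal_tendsto_simps F0 Finf\<close>)
  moreover have "(LBINT x=0..\<infinity>. f x) = (LBINT x:{0<..}. f x)"
    by (simp add: interval_lebesgue_integral_def ei)
  ultimately show ?thesis
    using set_borel_integral_eq_integral(2)[of "{0<..}" f] si by (simp add: ei)
qed

subsection \<open>The Mellin transform\<close>

text \<open>The integrand of \<open>Z_integral\<close> after the substitution u = e^t; the Jacobian
  e^t turns the exponent -s-1 into -s.\<close>

definition mellin_kernel :: "nat \<Rightarrow> complex \<Rightarrow> complex \<Rightarrow> real \<Rightarrow> complex" where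
  "mellin_kernel r s w t = (exp (of_real t) - 1) ^ r * exp (- (s * of_real t)) * of_real t powr (w - 1)"

text \<open>Up to the sign (-1)^r, the r-th backward difference of s^(-w) in the variable s.\<close>

definition binomial_zeta :: "nat \<Rightarrow> complex \<Rightarrow> complex \<Rightarrow> complex" where
  "binomial_zeta r s w = (\<Sum>k\<le>r. (-1) ^ (r - k) * of_nat (r choose k) * (s - of_nat k) powr (- w))"

section \<open>Size of the kernel and its exact half-plane of convergence\<close>

lemma continuous_on_mellin_kernel: "continuous_on {0<..} (mellin_kernel r s w)"
  unfolding mellin_kernel_def
  by (auto intro!: continuous_intros simp: complex_nonpos_Reals_iff)

lemma norm_exp_minus_1: "t > 0 \<Longrightarrow> norm (exp (complex_of_real t) - 1) = exp t - 1"
  by (metis abs_of_nonneg exp_of_real less_eq_real_def norm_of_real of_real_1 of_real_diff 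
      one_le_exp_iff diff_ge_0_iff_ge)

lemma norm_mellin_kernel:
  "t > 0 \<Longrightarrow> norm (mellin_kernel r s w t) = (exp t - 1) ^ r * exp (- (Re s * t)) * t powr (Re w - 1)"
  by (simp add: mellin_kernel_def norm_mult norm_power norm_exp_minus_1 norm_powr_real_powr)

text \<open>Multiply 1 - t \<le> e^(-t) by e^t and take powers. The bound records both the zero of
  order r at 0 and the growth at infinity.\<close>

lemma exp_minus_1_power_le: "t > 0 \<Longrightarrow> (exp t - 1) ^ r \<le> t ^ r * exp (real r * t)"
proof -
  assume t: "t > (0::real)"
  have "1 - t \<le> exp (- t)" using exp_ge_add_one_self[of "- t"] by simp
  then have "(1 - t) * exp t \<le> exp (- t) * exp t" by (intro mult_right_mono) auto
  then have "exp t - 1 \<le> t * exp t" by (simp add: exp_minus field_simps)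
  then have "(exp t - 1) ^ r \<le> (t * exp t) ^ r" using t by (intro power_mono) auto
  also have "\<dots> = t ^ r * exp (real r * t)" by (simp add: power_mult_distrib exp_of_nat_mult)
  finally show ?thesis .
qed

lemma norm_mellin_kernel_le:
  assumes t: "t > 0"
  shows "norm (mellin_kernel r s w t) \<le> t powr (real r + Re w - 1) * exp (- ((Re s - real r) * t))"
proof -
  have "norm (mellin_kernel r s w t) \<le> (t ^ r * exp (real r * t)) * exp (- (Re s * t)) * t powr (Re w - 1)"
    unfolding norm_mellin_kernel[OF t]
    by (intro mult_right_mono exp_minus_1_power_le t) auto
  also have "\<dots> = t powr (real r + (Re w - 1)) * exp (real r * t + - (Re s * t))"
    using t by (simp only: powr_add powr_realpow exp_add mult_ac)
  also have "\<dots> = t powr (real r + Re w - 1) * exp (- ((Re s - real r) * t))"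
    by (simp add: algebra_simps)
  finally show ?thesis .
qed

text \<open>The dominating function is the norm of a gamma integrand with w raised by r, thanks to
  the zero at 0, and s lowered by r, because of the growth of (e^t - 1)^r.\<close>

lemma mellin_kernel_integrable:
  assumes s: "Re s > real r" and w: "Re w > - real r"
  shows "mellin_kernel r s w absolutely_integrable_on {0<..}"
proof -
  let ?G = "\<lambda>t. of_real t powr ((of_nat r + w) - 1) * exp (- ((s - of_nat r) * complex_of_real t))"
  have "?G absolutely_integrable_on {0<..}"
    by (rule gamma_exp_integral) (use s w in auto)
  then have g: "(\<lambda>t. norm (?G t)) integrable_on {0<..}"
    by (simp add: absolutely_integrable_on_def)
  have le: "norm (mellin_kernel r s w t) \<le> norm (?G t)" if "t \<in> {0<..}" for t
    using norm_mellin_kernel_le[of t r s w] that by (simp add: norm_mult norm_powr_real_powr)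
  have "mellin_kernel r s w integrable_on {0<..}"
    by (rule measurable_bounded_by_integrable_imp_integrable[OF _ g le])
       (auto intro!: continuous_imp_measurable_on_sets_lebesgue continuous_on_mellin_kernel)
  then show ?thesis
    using g le by (intro absolutely_integrable_integrable_bound[where g = "\<lambda>t. norm (?G t)"]) auto
qed

lemma inverse_not_integrable: "\<not> (\<lambda>t::real. inverse t) integrable_on {0<..1}"
proof
  assume int: "(\<lambda>t::real. inverse t) integrable_on {0<..1}"
  define I where "I = integral {0<..1} (\<lambda>t::real. inverse t)"
  have I: "- ln e \<le> I" if e: "0 < e" "e \<le> 1" for e
  proof -
    have "((\<lambda>t. inverse t) has_integral (ln 1 - ln e)) {e..1}"
      by (rule fundamental_theorem_of_calculus)
         (use e in \<open>auto intro!: derivative_eq_intros simp: inverse_eq_divide has_real_derivative_iff_has_vector_derivative[symmetric]\<close>)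
    then have "- ln e = integral {e..1} (\<lambda>t. inverse t)" "(\<lambda>t. inverse t) integrable_on {e..1}"
      by (auto simp: integral_unique has_integral_integrable)
    then show ?thesis
      unfolding I_def using int e by (auto intro!: integral_subset_le)
  qed
  \<comment> \<open>Nonnegativity makes \<open>exp (- (I + 1))\<close> an admissible lower endpoint;
    it would give I + 1 \<le> I.\<close>
  have "I \<ge> 0" using I[of 1] by simp
  then show False using I[of "exp (- (I + 1))"] by simp
qed

text \<open>If Re w \<le> -r, a constant multiple of the norm of the kernel dominates 1/t on (0,1].
  Since \<open>Z_continuation\<close> demands agreement at every point of convergence, the domain
  must be known exactly.\<close>

lemma mellin_kernel_integrableD:
  assumes "mellin_kernel r s w absolutely_integrable_on {0<..}"
  shows "Re w > - real r"
proof (rule ccontr)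
  assume w: "\<not> Re w > - real r"
  \<comment> \<open>On (0,1] this constant compensates the factor \<open>exp (- (Re s * t))\<close>,
    whatever the sign of \<open>Re s\<close>.\<close>
  define C where "C = exp \<bar>Re s\<bar>"
  have "mellin_kernel r s w absolutely_integrable_on {0<..1}"
    using assms by (rule set_integrable_subset) auto
  then have g: "(\<lambda>t. C * norm (mellin_kernel r s w t)) integrable_on {0<..1}"
    by (intro integrable_on_mult_right) (simp add: absolutely_integrable_on_def)
  have le: "norm (inverse t) \<le> C * norm (mellin_kernel r s w t)" if "t \<in> {0<..1}" for t :: real
  proof -
    have t: "t > 0" "t \<le> 1" using that by auto
    have 1: "t ^ r \<le> (exp t - 1) ^ r"
    proof (rule power_mono)
      show "t \<le> exp t - 1" using exp_ge_add_one_self[of t] by linarith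
    qed (use t in simp)
    have "Re s * t \<le> \<bar>Re s\<bar>" using t mult_mono[of "Re s" "\<bar>Re s\<bar>" t 1] by auto
    then have 2: "1 \<le> C * exp (- (Re s * t))" by (simp add: C_def flip: exp_add)
    have 3: "t powr (- real r - 1) \<le> t powr (Re w - 1)"
      using t w by (intro powr_mono') auto
    have "inverse t = t ^ r * 1 * t powr (- real r - 1)"
      using t by (simp add: powr_diff powr_minus powr_realpow field_simps)
    also have "\<dots> \<le> (exp t - 1) ^ r * (C * exp (- (Re s * t))) * t powr (Re w - 1)"
      using t by (intro mult_mono 1 2 3) (auto simp: C_def)
    also have "\<dots> = C * norm (mellin_kernel r s w t)"
      using t by (simp add: norm_mellin_kernel)
    finally show ?thesis using t by simp
  qed
  have "(\<lambda>t::real. inverse t) integrable_on {0<..1}"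
    by (rule measurable_bounded_by_integrable_imp_integrable[OF _ g le])
       (auto intro!: continuous_imp_measurable_on_sets_lebesgue continuous_intros)
  then show False using inverse_not_integrable by blast
qed

section \<open>Value at 0 and recursion of the binomial sum\<close>

text \<open>No base s - k vanishes, so every power is 1 (in contrast to
  \<open>0 powr 0 = 0\<close>), and what remains is the expansion of (1 - 1)^r.\<close>

lemma binomial_zeta_0: "r > 0 \<Longrightarrow> s \<notin> of_nat ` {0..r} \<Longrightarrow> binomial_zeta r s 0 = 0"
proof -
  assume r: "r > 0" and s: "s \<notin> of_nat ` {0..r}"
  have "binomial_zeta r s 0 = (\<Sum>k\<le>r. of_nat (r choose k) * 1 ^ k * (-1) ^ (r - k))"
    using s unfolding binomial_zeta_def by (intro sum.cong) auto
  also have "\<dots> = (1 + (-1)) ^ r" by (rule binomial_ring[symmetric])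
  finally show ?thesis using r by simp
qed

text \<open>Write (s-k)^(-w) as (s-k) times (s-k)^(-w-1); the part with factor k is absorbed into a
  binomial coefficient of order m. The shape matches the integration by parts in
  \<open>mellin_kernel_by_parts\<close>.\<close>

lemma binomial_zeta_rec:
  assumes s: "s \<notin> of_nat ` {0..Suc m}"
  shows "binomial_zeta (Suc m) s w =
    s * binomial_zeta (Suc m) s (w + 1) - of_nat (Suc m) * binomial_zeta m (s - 1) (w + 1)"
proof -
  let ?X = "\<lambda>k. (s - of_nat k) powr (- (w + 1))"
  let ?c = "\<lambda>k. (-1) ^ (Suc m - k) * of_nat (Suc m choose k) :: complex"
  have 1: "of_nat (Suc m) * binomial_zeta m (s - 1) (w + 1) = (\<Sum>k\<le>Suc m. of_nat k * ?c k * ?X k)"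
  proof -
    \<comment> \<open>The factor k kills the term k = 0, so the index shifts without a
      remainder.\<close>
    have "(\<Sum>k\<le>Suc m. of_nat k * ?c k * ?X k) = (\<Sum>j\<le>m. of_nat (Suc j) * ?c (Suc j) * ?X (Suc j))"
      by (subst sum.atMost_Suc_shift) simp
    also have "\<dots> = (\<Sum>j\<le>m. of_nat (Suc m) * ((-1) ^ (m - j) * of_nat (m choose j) * (s - 1 - of_nat j) powr (- (w + 1))))"
    proof (rule sum.cong[OF refl])
      fix j
      have absorb: "of_nat (Suc j) * of_nat (Suc m choose Suc j) = (of_nat (Suc m) * of_nat (m choose j) :: complex)"
        by (simp only: Suc_times_binomial flip: of_nat_mult)
      have shift: "s - of_nat (Suc j) = s - 1 - of_nat j" by simp
      have "of_nat (Suc j) * ?c (Suc j) * ?X (Suc j) =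
          (of_nat (Suc j) * of_nat (Suc m choose Suc j)) * ((-1) ^ (m - j) * ?X (Suc j))"
        by (simp only: diff_Suc_Suc mult_ac)
      then show "of_nat (Suc j) * ?c (Suc j) * ?X (Suc j) = of_nat (Suc m) * ((-1) ^ (m - j) * of_nat (m choose j) * (s - 1 - of_nat j) powr (- (w + 1)))"
        by (simp only: absorb shift mult_ac)
    qed
    finally show ?thesis by (simp only: binomial_zeta_def sum_distrib_left)
  qed
  have "binomial_zeta (Suc m) s w = (\<Sum>k\<le>Suc m. s * (?c k * ?X k) - of_nat k * ?c k * ?X k)"
    unfolding binomial_zeta_def
  proof (rule sum.cong[OF refl])
    fix k assume "k \<in> {..Suc m}"
    then have "s - of_nat k \<noteq> 0" using s by force
    then have "(s - of_nat k) powr (- w) = (s - of_nat k) * ?X k"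
      by (simp add: powr_diff powr_minus)
    then show "?c k * (s - of_nat k) powr (- w) = s * (?c k * ?X k) - of_nat k * ?c k * ?X k"
      by (simp only: left_diff_distrib right_diff_distrib mult_ac)
  qed
  then show ?thesis
    unfolding 1 by (simp only: sum_subtractf binomial_zeta_def sum_distrib_left)
qed

section \<open>Evaluation of the Mellin integral\<close>

text \<open>Expand (e^t - 1)^r and integrate termwise. The separate terms converge at 0 only for Re
  w > 0, which is why the wider half-plane needs another argument.\<close>

lemma mellin_kernel_integral_Re_pos:
  assumes s: "Re s > real r" and w: "Re w > 0"
  shows "rGamma w * integral {0<..} (mellin_kernel r s w) = binomial_zeta r s w"
proof -
  let ?c = "\<lambda>k. (-1) ^ (r - k) * of_nat (r choose k) :: complex"
  let ?E = "\<lambda>k t. of_real t powr (w - 1) * exp (- ((s - of_nat k) * complex_of_real t))"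
  have a: "Re (s - of_nat k) > 0" if "k \<in> {..r}" for k using s that by simp
  note G = gamma_exp_integral[OF w a]
  have int: "(\<lambda>t. ?c k * ?E k t) integrable_on {0<..}" if "k \<in> {..r}" for k
    using G(1)[OF that] by (intro integrable_on_mult_right set_lebesgue_integral_eq_integral(1))
  have "mellin_kernel r s w = (\<lambda>t. \<Sum>k\<le>r. ?c k * ?E k t)"
  proof
    fix t
    have "(exp (complex_of_real t) - 1) ^ r = (\<Sum>k\<le>r. of_nat (r choose k) * exp (of_real t) ^ k * (-1) ^ (r - k))"
      by (subst binomial_ring[symmetric]) simp
    moreover have e: "exp (- ((s - of_nat k) * complex_of_real t)) = exp (- (s * complex_of_real t)) * exp (of_real t) ^ k" for k
      by (simp add: algebra_simps flip: exp_of_nat_mult exp_add)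
    ultimately show "mellin_kernel r s w t = (\<Sum>k\<le>r. ?c k * ?E k t)"
      unfolding mellin_kernel_def e by (simp add: sum_distrib_left sum_distrib_right mult_ac)
  qed
  then have "integral {0<..} (mellin_kernel r s w) = (\<Sum>k\<le>r. integral {0<..} (\<lambda>t. ?c k * ?E k t))"
    using int by (simp only: Henstock_Kurzweil_Integration.integral_sum[OF finite_atMost])
  also have "\<dots> = (\<Sum>k\<le>r. ?c k * integral {0<..} (?E k))"
    by (simp only: integral_mult_right)
  also have "\<dots> = Gamma w * binomial_zeta r s w"
    unfolding binomial_zeta_def sum_distrib_left
    by (intro sum.cong refl) (simp add: G(2))
  finally show ?thesis
    using w Gamma_eq_zero_iff[of w] 
    by (auto simp: rGamma_inverse_Gamma elim!: nonpos_Ints_cases')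
qed

text \<open>These limits are the boundary terms of the integration by parts, where the lemma is used
  with w + 1 in place of w.\<close>

lemma mellin_kernel_tendsto_0:
  assumes s: "Re s > real r" and w: "Re w > 1 - real r"
  shows "(mellin_kernel r s w \<longlongrightarrow> 0) (at_right 0)" "(mellin_kernel r s w \<longlongrightarrow> 0) at_top"
proof -
  define p q where "p = real r + Re w - 1" and "q = Re s - real r"
  have pq: "p > 0" "q > 0" using s w by (auto simp: p_def q_def)
  have le: "norm (mellin_kernel r s w t) \<le> t powr p * exp (- (q * t))" if "t > 0" for t
    using norm_mellin_kernel_le[OF that] by (simp add: p_def q_def)
  have "((\<lambda>t. t powr p * exp (- (q * t))) \<longlongrightarrow> 0) (at_right 0)" using pq by real_asymp
  then show "(mellin_kernel r s w \<longlongrightarrow> 0) (at_right 0)"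
    by (rule Lim_null_comparison[rotated]) (auto simp: eventually_at_filter le intro!: always_eventually)
  have "((\<lambda>t. t powr p * exp (- (q * t))) \<longlongrightarrow> 0) at_top" using pq by real_asymp
  then show "(mellin_kernel r s w \<longlongrightarrow> 0) at_top"
    by (rule Lim_null_comparison[rotated]) (auto intro: eventually_mono[OF eventually_gt_at_top[of 0]] le)
qed

text \<open>Integrate the derivative of the kernel at w + 1. Its three terms come from the product
  rule; differentiating the power of e^t - 1 leaves a factor e^t, which turns s into s - 1.\<close>

lemma mellin_kernel_by_parts:
  assumes s: "Re s > real (Suc m)" and w: "Re w > - real (Suc m)"
  shows "w * integral {0<..} (mellin_kernel (Suc m) s w) =
     s * integral {0<..} (mellin_kernel (Suc m) s (w + 1)) -
     of_nat (Suc m) * integral {0<..} (mellin_kernel m (s - 1) (w + 1))"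
proof -
  let ?f = "\<lambda>t. w * mellin_kernel (Suc m) s w t + of_nat (Suc m) * mellin_kernel m (s - 1) (w + 1) t
     - s * mellin_kernel (Suc m) s (w + 1) t"
  have i: "mellin_kernel (Suc m) s w absolutely_integrable_on {0<..}"
    "mellin_kernel (Suc m) s (w + 1) absolutely_integrable_on {0<..}"
    "mellin_kernel m (s - 1) (w + 1) absolutely_integrable_on {0<..}"
    using s w by (auto intro!: mellin_kernel_integrable)
  note i' = i[THEN set_lebesgue_integral_eq_integral(1)]
  have "integral {0<..} ?f = 0"
  proof (rule integral_derivative_zero_limits[where F = "mellin_kernel (Suc m) s (w + 1)"])
    fix t :: real assume t: "t > 0"
    let ?T = "complex_of_real t"
    have d1: "((\<lambda>z. (exp z - 1) ^ Suc m) has_field_derivative of_nat (Suc m) * ((exp ?T - 1) ^ m * exp ?T)) (at ?T)"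
      by (rule DERIV_power_Suc[THEN DERIV_cong]) (auto intro!: derivative_eq_intros)
    have d2: "((\<lambda>z. exp (- (s * z))) has_field_derivative - (s * exp (- (s * ?T)))) (at ?T)"
      by (auto intro!: derivative_eq_intros)
    have d3: "((\<lambda>z. z powr w) has_field_derivative w * ?T powr (w - 1)) (at ?T)"
      using t by (intro has_field_derivative_powr) (simp add: complex_nonpos_Reals_iff)
    have e: "exp (- ((s - 1) * ?T)) = exp ?T * exp (- (s * ?T))"
      by (simp add: algebra_simps flip: exp_add)
    \<comment> \<open>The kernel is differentiated in a complex variable and then restricted to the
      real line; the exponent \<open>w + 1 - 1\<close> is kept so that it matches the unfolded
      kernel.\<close>
    have "((\<lambda>z. (exp z - 1) ^ Suc m * exp (- (s * z)) * z powr (w + 1 - 1)) has_field_derivative ?f t) (at ?T)"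
      unfolding add_diff_cancel_right'
      by (rule DERIV_mult[OF DERIV_mult[OF d1 d2] d3, THEN DERIV_cong])
         (simp only: mellin_kernel_def e add_diff_cancel_right', simp add: algebra_simps del: power_Suc of_nat_Suc)
    then show "(mellin_kernel (Suc m) s (w + 1) has_vector_derivative ?f t) (at t)"
      unfolding mellin_kernel_def[abs_def] by (rule has_vector_derivative_real_field)
  next
    show "continuous_on {0<..} ?f"
      by (intro continuous_intros continuous_on_mellin_kernel)
    show "?f absolutely_integrable_on {0<..}"
      using i by (intro set_integral_add set_integral_diff set_integrable_mult_right) auto
  qed (use s w in \<open>auto intro!: mellin_kernel_tendsto_0\<close>)
  moreover have "integral {0<..} ?f = w * integral {0<..} (mellin_kernel (Suc m) s w)
     + of_nat (Suc m) * integral {0<..} (mellin_kernel m (s - 1) (w + 1))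
     - s * integral {0<..} (mellin_kernel (Suc m) s (w + 1))"
    using i' by (subst Henstock_Kurzweil_Integration.integral_diff | subst Henstock_Kurzweil_Integration.integral_add |
       intro integrable_add integrable_on_mult_right | simp)+
  ultimately show ?thesis by (simp add: algebra_simps)
qed

text \<open>Both sides obey the same recursion, once 1/Gamma(w) = w/Gamma(w+1) is used. The
  induction runs over the depth n of the half-plane Re w > -n, with r and s free because the step
  changes them.\<close>

lemma mellin_kernel_integral:
  assumes "Re s > real r" and "Re w > - real r"
  shows "rGamma w * integral {0<..} (mellin_kernel r s w) = binomial_zeta r s w"
proof -
  have "rGamma w * integral {0<..} (mellin_kernel r s w) = binomial_zeta r s w"
    if "Re w > - real n" "Re s > real r" "Re w > - real r" for n
    using that
  proof (induction n arbitrary: r s w)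
    case 0
    then show ?case by (intro mellin_kernel_integral_Re_pos) auto
  next
    case (Suc n)
    have s: "s \<notin> of_nat ` {0..r}" using Suc.prems(2) by auto
    \<comment> \<open>For r = 0 the convergence hypothesis already forces Re w > 0, so in the
      remaining cases r has a predecessor. At w = 0 both sides vanish.\<close>
    consider "Re w > 0" | "w = 0" "r > 0" | "w \<noteq> 0" "Re w \<le> 0" "r > 0"
      using Suc.prems(3) by (cases "r = 0") force+
    then show ?case
    proof cases
      case 1
      then show ?thesis using Suc.prems by (intro mellin_kernel_integral_Re_pos)
    next
      case 2
      then show ?thesis using s by (simp add: binomial_zeta_0)
    next
      case 3
      then obtain m where m: "r = Suc m" using gr0_implies_Suc by blast
      have "rGamma w * integral {0<..} (mellin_kernel r s w) =
            rGamma (w + 1) * (w * integral {0<..} (mellin_kernel r s w))"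
        by (subst rGamma_plus1[symmetric]) simp
      also have "\<dots> = s * (rGamma (w + 1) * integral {0<..} (mellin_kernel r s (w + 1))) -
          of_nat r * (rGamma (w + 1) * integral {0<..} (mellin_kernel m (s - 1) (w + 1)))"
        unfolding m using Suc.prems m by (subst mellin_kernel_by_parts) (simp_all add: algebra_simps)
      also have "\<dots> = s * binomial_zeta r s (w + 1) - of_nat r * binomial_zeta m (s - 1) (w + 1)"
        using Suc.prems m by (subst (1 2) Suc.IH) auto
      also have "\<dots> = binomial_zeta r s w"
        using s unfolding m by (intro binomial_zeta_rec[symmetric])
      finally show ?thesis .
    qed
  qed
  from this[of r] show ?thesis using assms by blast
qed

subsection \<open>The zeta function as a rational function\<close>

lemma coprime_linear_polys: "a \<noteq> b \<Longrightarrow> coprime [:- a, 1:] [:- b, 1 :: complex:]"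
proof (rule coprimeI)
  fix d :: "complex poly"
  assume ab: "a \<noteq> b" and d: "d dvd [:- a, 1:]" "d dvd [:- b, 1:]"
  from dvd_diff[OF d] have "d dvd [:b - a:]" by simp
  moreover have "[:b - a:] dvd 1" using ab by (simp add: is_unit_const_poly_iff dvd_field_iff)
  ultimately show "d dvd 1" using dvd_trans by blast
qed

text \<open>Cross-multiplication gives a polynomial identity, and coprimality makes the denominators
  divide each other. They thus have the same zeros, so the quotients agree even at poles, where both
  are 0.\<close>

lemma rational_function_unique:
  fixes p q p' q' :: "complex poly"
  assumes "q \<noteq> 0" "q' \<noteq> 0" "coprime p q" "coprime p' q'" "infinite A"
    and eq: "\<And>s. s \<in> A \<Longrightarrow> poly p s / poly q s = poly p' s / poly q' s"
  shows "poly p s / poly q s = poly p' s / poly q' s"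
proof -
  \<comment> \<open>The extra factor \<open>q * q'\<close> covers the points of \<open>A\<close> at
    which a denominator vanishes.\<close>
  have "poly ((p * q' - p' * q) * (q * q')) s = 0" if "s \<in> A" for s
    using eq[OF that] by (cases "poly q s = 0"; cases "poly q' s = 0") (auto simp: field_simps)
  then have "A \<subseteq> {s. poly ((p * q' - p' * q) * (q * q')) s = 0}" by blast
  then have "infinite {s. poly ((p * q' - p' * q) * (q * q')) s = 0}"
    using \<open>infinite A\<close> infinite_super by blast
  then have "(p * q' - p' * q) * (q * q') = 0" using poly_roots_finite by blast
  then have cross: "p * q' = p' * q" using assms by auto
  have "q dvd p * q'" by (simp add: cross)
  moreover have "q' dvd p' * q" by (simp flip: cross)
  ultimately have "q dvd q'" "q' dvd q"
    using assms by (simp_all add: coprime_dvd_mult_right_iff coprime_commute)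
  then have "poly q s = 0 \<longleftrightarrow> poly q' s = 0"
    by (metis dvd_trans poly_eq_0_iff_dvd)
  moreover have "poly p s * poly q' s = poly p' s * poly q s"
    using arg_cong[OF cross, of "\<lambda>f. poly f s"] by simp
  ultimately show ?thesis by (cases "poly q s = 0") (auto simp: field_simps)
qed

section \<open>Substitution u = e^t and analytic continuation in w\<close>

lemma Z_integrand_exp:
  "exp t *\<^sub>R Z_integrand (\<lambda>u. of_real ((u - 1) ^ r)) s w (exp t) = mellin_kernel r s w t"
proof -
  have "complex_of_real (exp t) powr (- s - 1) = exp ((- s - 1) * of_real t)"
    by (simp add: powr_def Ln_of_real)
  moreover have "exp (- (s * complex_of_real t)) = exp (of_real t) * exp ((- s - 1) * of_real t)"
    by (simp add: algebra_simps flip: exp_add)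
  ultimately show ?thesis
    by (simp add: Z_integrand_def mellin_kernel_def scaleR_conv_of_real exp_of_real)
qed

text \<open>Stated as an equivalence with a free value \<open>b\<close>, so that one application of
  the substitution carries convergence in both directions along with the integral.\<close>

lemma Z_integrand_change_of_variables:
  "Z_integrand (\<lambda>u. of_real ((u - 1) ^ r)) s w absolutely_integrable_on {1<..} \<and>
     integral {1<..} (Z_integrand (\<lambda>u. of_real ((u - 1) ^ r)) s w) = b \<longleftrightarrow>
   mellin_kernel r s w absolutely_integrable_on {0<..} \<and> integral {0<..} (mellin_kernel r s w) = b"
proof -
  have "x \<in> exp ` {0<..}" if "x > 1" for x :: real
    using that by (intro image_eqI[of _ _ "ln x"]) auto
  then have "exp ` {0<..} = {1::real<..}" by auto
  then show ?thesis
    using has_absolute_integral_change_of_variables_real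
      [of "{0<..}" exp exp "Z_integrand (\<lambda>u. of_real ((u - 1) ^ r)) s w" b]
    by (simp add: Z_integrand_exp inj_on_def DERIV_exp has_field_derivative_at_within del: of_real_power of_real_diff)
qed

lemma Z_conv_domain_power:
  assumes "Re s > real r"
  shows "Z_conv_domain (\<lambda>u. of_real ((u - 1) ^ r)) s = {w. Re w > - real r}"
  unfolding Z_conv_domain_def
  using Z_integrand_change_of_variables[of r s] mellin_kernel_integrableD[of r s]
    mellin_kernel_integrable[OF assms] by blast

lemma Z_integral_power:
  assumes "Re s > real r" "Re w > - real r"
  shows "Z_integral (\<lambda>u. of_real ((u - 1) ^ r)) s w = binomial_zeta r s w"
  using mellin_kernel_integrable[OF assms] Z_integrand_change_of_variables[of r s w]
    mellin_kernel_integral[OF assms] unfolding Z_integral_def by metis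

lemma binomial_zeta_has_derivative:
  assumes "s \<notin> of_nat ` {0..r}"
  shows "(binomial_zeta r s has_field_derivative
     (\<Sum>k\<le>r. (-1) ^ (r - k) * of_nat (r choose k) * (- (Ln (s - of_nat k) * (s - of_nat k) powr (- w))))) (at w)"
proof -
  have *: "s - of_nat k \<noteq> 0" if "k \<le> r" for k using assms that by force
  show ?thesis
    unfolding binomial_zeta_def[abs_def]
    by (rule DERIV_sum, rule DERIV_cmult, rule DERIV_cong, rule DERIV_chain2[of "\<lambda>z. _ powr z" _ uminus],
        rule has_field_derivative_powr_right) (use * in \<open>auto intro!: derivative_eq_intros\<close>)
qed

text \<open>The domain of convergence is a nonempty open half-plane on which the integral equals an
  entire function of w; the identity theorem excludes any other continuation.\<close>

lemma Z_continuation_power_iff: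
  assumes s: "Re s > real r"
  shows "Z_continuation (\<lambda>u. of_real ((u - 1) ^ r)) s Z \<longleftrightarrow> Z = binomial_zeta r s"
proof -
  let ?D = "{w. Re w > - real r}"
  have D: "open ?D" "?D \<noteq> {}"
    by (auto simp: open_halfspace_Re_gt intro!: exI[of _ 1])
  have "s \<notin> of_nat ` {0..r}" using s by auto
  note der = binomial_zeta_has_derivative[OF this]
  have hol: "binomial_zeta r s holomorphic_on UNIV"
    using der by (meson holomorphic_onI field_differentiable_def has_field_derivative_at_within)
  have int: "interior ?D \<noteq> {}" using D by (simp add: interior_open)
  have iff: "(\<forall>w\<in>?D. Z w = Z_integral (\<lambda>u. of_real ((u - 1) ^ r)) s w) \<longleftrightarrow> (\<forall>w\<in>?D. Z w = binomial_zeta r s w)"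
    by (intro ball_cong refl) (simp only: mem_Collect_eq Z_integral_power[OF s])
  have "Z = binomial_zeta r s" if "Z holomorphic_on UNIV" "\<forall>w\<in>?D. Z w = binomial_zeta r s w"
    using analytic_continuation_open[of ?D UNIV Z "binomial_zeta r s"] D hol that by blast
  then show ?thesis
    unfolding Z_continuation_def Z_conv_domain_power[OF s] iff using int hol by blast
qed

text \<open>The derivative at 0 is an integer combination of the logarithms of s - k, so the
  exponential removes the choice of branch and leaves integer powers.\<close>

lemma exp_deriv_binomial_zeta:
  assumes s: "s \<notin> of_nat ` {0..r}"
  shows "exp (deriv (binomial_zeta r s) 0) =
    (\<Prod>k | k \<le> r \<and> odd (r - k). (s - of_nat k) ^ (r choose k)) /
    (\<Prod>k | k \<le> r \<and> even (r - k). (s - of_nat k) ^ (r choose k))"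
proof -
  have nz: "s - of_nat k \<noteq> 0" if "k \<le> r" for k using s that by force
  have "deriv (binomial_zeta r s) 0 =
      (\<Sum>k\<le>r. (-1) ^ (r - k) * of_nat (r choose k) * (- (Ln (s - of_nat k) * (s - of_nat k) powr (- 0))))"
    by (rule DERIV_imp_deriv) (rule binomial_zeta_has_derivative[OF s])
  then have "exp (deriv (binomial_zeta r s) 0) =
      (\<Prod>k\<le>r. exp ((-1) ^ (r - k) * of_nat (r choose k) * (- (Ln (s - of_nat k) * (s - of_nat k) powr (- 0)))))"
    by (simp add: exp_sum)
  also have "\<dots> = (\<Prod>k\<le>r. if odd (r - k) then (s - of_nat k) ^ (r choose k) else inverse ((s - of_nat k) ^ (r choose k)))"
    by (rule prod.cong) (auto simp: nz[simplified] exp_minus exp_of_nat_mult)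
  also have "\<dots> = (\<Prod>k\<in>{..r} \<inter> {k. odd (r - k)}. (s - of_nat k) ^ (r choose k)) *
      (\<Prod>k\<in>{..r} \<inter> - {k. odd (r - k)}. inverse ((s - of_nat k) ^ (r choose k)))"
    by (rule prod.If_cases) simp
  also have "{..r} \<inter> {k. odd (r - k)} = {k. k \<le> r \<and> odd (r - k)}" by auto
  also have "{..r} \<inter> - {k. odd (r - k)} = {k. k \<le> r \<and> even (r - k)}" by auto
  finally show ?thesis unfolding divide_inverse prod_inversef[symmetric] o_def .
qed

text \<open>The explicit quotient meets the description in \<open>abs_zeta\<close>, with
  \<open>real r\<close> as the bound of the half-plane, and is the only function to do so. Its
  product formula then gives the value at every s outside {0..r}.\<close>

lemma zeta_Gm_tensor_eq:
  assumes s: "s \<notin> of_nat ` {0..r}"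
  shows "zeta_Gm_tensor r s = exp (deriv (binomial_zeta r s) 0)"
proof -
  let ?N = "\<lambda>u. complex_of_real ((u - 1) ^ r)"
  define p q where "p = (\<Prod>k | k \<le> r \<and> odd (r - k). [:- of_nat k, 1 :: complex:] ^ (r choose k))"
    and "q = (\<Prod>k | k \<le> r \<and> even (r - k). [:- of_nat k, 1 :: complex:] ^ (r choose k))"
  have q0: "q \<noteq> 0" by (simp add: q_def)
  \<comment> \<open>The roots k of \<open>p\<close> and of \<open>q\<close> are separated by the
    parity of r - k.\<close>
  have cop: "coprime p q"
    unfolding p_def q_def
    by (intro prod_coprime_left prod_coprime_right)
       (auto intro!: coprime_linear_polys simp: coprime_power_left_iff coprime_power_right_iff)
  have pq: "poly p s / poly q s = exp (deriv (binomial_zeta r s) 0)" if "s \<notin> of_nat ` {0..r}" for s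
    unfolding exp_deriv_binomial_zeta[OF that]
    by (simp add: p_def q_def poly_prod)
  let ?P = "\<lambda>R. \<exists>p q :: complex poly. q \<noteq> 0 \<and> coprime p q \<and> R = (\<lambda>s. poly p s / poly q s) \<and>
      (\<exists>\<sigma>::real. \<forall>s. Re s > \<sigma> \<longrightarrow> (\<exists>Z. Z_continuation ?N s Z \<and> R s = exp (deriv Z 0)))"
  have halfplane: "poly p s / poly q s = exp (deriv (binomial_zeta r s) 0)" if "Re s > real r" for s
    using that by (intro pq) auto
  have "abs_zeta ?N = (\<lambda>s. poly p s / poly q s)"
    unfolding abs_zeta_def
  proof (rule the_equality)
    have "\<exists>Z. Z_continuation ?N s Z \<and> poly p s / poly q s = exp (deriv Z 0)" if "Re s > real r" for s
      using halfplane[OF that] Z_continuation_power_iff[OF that] by blast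
    then show "?P (\<lambda>s. poly p s / poly q s)"
      using q0 cop by blast
  next
    fix R assume "?P R"
    then obtain p' q' \<sigma> where R: "q' \<noteq> 0" "coprime p' q'" "R = (\<lambda>s. poly p' s / poly q' s)"
      and Z: "\<And>s. Re s > \<sigma> \<Longrightarrow> \<exists>Z. Z_continuation ?N s Z \<and> R s = exp (deriv Z 0)" by blast
    \<comment> \<open>On this real ray both the competing description and the explicit formula hold,
      and infinitely many common values suffice.\<close>
    have "infinite (of_real ` {max \<sigma> (real r)<..} :: complex set)"
      by (subst finite_image_iff) (auto simp: infinite_Ioi inj_on_def)
    moreover have "poly p' s / poly q' s = poly p s / poly q s" if "s \<in> of_real ` {max \<sigma> (real r)<..}" for s
    proof -
      have s: "Re s > \<sigma>" "Re s > real r" using that by auto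
      show ?thesis
        using Z[OF s(1)] halfplane[OF s(2)] unfolding R(3) Z_continuation_power_iff[OF s(2)] by auto
    qed
    ultimately show "R = (\<lambda>s. poly p s / poly q s)"
      unfolding R(3) using rational_function_unique[OF R(1) q0 R(2) cop] by blast
  qed
  then show ?thesis
    unfolding zeta_Gm_tensor_def using pq[OF s] by simp
qed

section \<open>Gamma functions of negative order and the functional equation\<close>

text \<open>Reverse the summation by k = r - n, using n + (s - r) = s - (r - n) and the symmetry of
  the binomial coefficients.\<close>

lemma zeta_neg_eq_binomial_zeta: "zeta_neg r w (s - of_nat r) = binomial_zeta r s w"
proof -
  have "binomial_zeta r s w = (\<Sum>k\<le>r. (-1) ^ (r - (r - k)) * of_nat (r choose (r - k)) * (s - of_nat (r - k)) powr (- w))"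
    unfolding binomial_zeta_def by (rule sum.nat_diff_reindex[symmetric, of _ "Suc r", unfolded lessThan_Suc_atMost, simplified])
  also have "\<dots> = zeta_neg r w (s - of_nat r)"
    unfolding zeta_neg_def atLeast0AtMost
    by (rule sum.cong) (auto simp: of_nat_diff algebra_simps simp flip: binomial_symmetric)
  finally show ?thesis ..
qed

lemma zeta_Gm_tensor_eq_Gamma_neg:
  assumes "s \<notin> of_nat ` {0..r}"
  shows "zeta_Gm_tensor r s = Gamma_neg r (s - of_nat r)"
  unfolding zeta_Gm_tensor_eq[OF assms] Gamma_neg_def zeta_neg_eq_binomial_zeta ..

theorem theorem4:
  fixes r :: nat and s :: complex
  assumes "r > 0"
    and "s \<notin> of_nat ` {0..r}"
  shows "zeta_Gm_tensor r s / (zeta_Gm_tensor r (of_nat r - s)) powi ((-1) ^ r)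
           = inverse (S_neg r (s - of_nat r))"
proof -
  \<comment> \<open>The excluded set is symmetric under the reflection of s to r - s, so the gamma
    formula also applies to the second zeta value.\<close>
  have "of_nat r - s \<notin> of_nat ` {0..r}"
  proof
    assume "of_nat r - s \<in> of_nat ` {0..r}"
    then obtain k where k: "k \<le> r" "of_nat r - s = of_nat k" by auto
    then have "s = of_nat (r - k)" by (simp add: of_nat_diff algebra_simps)
    then show False using assms(2) by auto
  qed
  \<comment> \<open>For x = s - r the reflected argument -r - x in \<open>S_neg\<close> equals (r -
    s) - r, so the two zeta values are exactly the two gamma values there.\<close>
  then show ?thesis
    using assms(2) by (simp add: zeta_Gm_tensor_eq_Gamma_neg S_neg_def divide_inverse)
qed

end
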